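(* Let $\lambda_1,\lambda_2,\lambda_1',\lambda_2'\in\mathbb{C}^*$ be such that the quandle $M_{\lambda_1,\lambda_2}$ is isomorphic to the quandle $M_{\lambda_1',\lambda_2'}$, where $\lambda_2/\lambda_1$ is not a root of unity. Then $M_{\lambda_1^n,\lambda_2^n}$ is isomorphic to $M_{\lambda_1'^n,\lambda_2'^n}$ for all positive integers $n$.
   Context: A quandle is a non-empty set $Q$ with a binary operation $*$ such that: (Q1) $x*x=x$ for all $x$; (Q2) for all $x,y\in Q$ there is a unique $z\in Q$ with $x=z*y$; (Q3) $(x*y)*z=(x*z)*(y*z)$ for all $x,y,z$. A quandle isomorphism is a bijection $\phi$ with $\phi(x*y)=\phi(x)*\phi(y)$. For $\lambda_1,\lambda_2\in\mathbb{C}^*$, $M_{\lambda_1,\lambda_2}$ is the conjugacy class in $\operatorname{GL}(2,\mathbb{C})$ of $\begin{pmatrix}\lambda_1&0\\0&\lambda_2\end{pmatrix}$, regarded as a quandle with operation $X*Y=Y^{-1}XY$. A complex number $z$ is a root of unity if $z^n=1$ for some positive integer $n$. *)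

theory Defs
  imports "HOL-Analysis.Analysis"
begin

locale quandle =
  fixes Q :: "'a set" and op :: "'a \<Rightarrow> 'a \<Rightarrow> 'a"
  assumes nonempty: "Q \<noteq> {}"
    and closed: "\<lbrakk>x \<in> Q; y \<in> Q\<rbrakk> \<Longrightarrow> op x y \<in> Q"
    and idem: "x \<in> Q \<Longrightarrow> op x x = x"
    and right_division: "\<lbrakk>x \<in> Q; y \<in> Q\<rbrakk> \<Longrightarrow> \<exists>!z. z \<in> Q \<and> x = op z y"
    and self_distrib: "\<lbrakk>x \<in> Q; y \<in> Q; z \<in> Q\<rbrakk> \<Longrightarrow> op (op x y) z = op (op x z) (op y z)"

definition quandle_iso :: "'a set \<Rightarrow> ('a \<Rightarrow> 'a \<Rightarrow> 'a) \<Rightarrow> 'b set \<Rightarrow> ('b \<Rightarrow> 'b \<Rightarrow> 'b) \<Rightarrow> ('a \<Rightarrow> 'b) \<Rightarrow> bool"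
  where "quandle_iso Q op Q' op' \<phi> \<longleftrightarrow>
    bij_betw \<phi> Q Q' \<and> (\<forall>x\<in>Q. \<forall>y\<in>Q. \<phi> (op x y) = op' (\<phi> x) (\<phi> y))"

definition isomorphic_quandles :: "'a set \<Rightarrow> ('a \<Rightarrow> 'a \<Rightarrow> 'a) \<Rightarrow> 'b set \<Rightarrow> ('b \<Rightarrow> 'b \<Rightarrow> 'b) \<Rightarrow> bool"
  where "isomorphic_quandles Q op Q' op' \<longleftrightarrow>
    quandle Q op \<and> quandle Q' op' \<and> (\<exists>\<phi>. quandle_iso Q op Q' op' \<phi>)"

definition GL2 :: "(complex^2^2) set"
  where "GL2 = {A. invertible A}"

definition conj_op :: "complex^2^2 \<Rightarrow> complex^2^2 \<Rightarrow> complex^2^2"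
  where "conj_op X Y = matrix_inv Y ** X ** Y"

definition GL2_conj_class :: "complex^2^2 \<Rightarrow> (complex^2^2) set"
  where "GL2_conj_class A = {conj_op A P | P. P \<in> GL2}"

definition diag2 :: "complex \<Rightarrow> complex \<Rightarrow> complex^2^2"
  where "diag2 a b = vector [vector [a, 0], vector [0, b]]"

definition M_quandle :: "complex \<Rightarrow> complex \<Rightarrow> (complex^2^2) set"
  where "M_quandle a b = GL2_conj_class (diag2 a b)"

definition root_of_unity :: "complex \<Rightarrow> bool"
  where "root_of_unity z \<longleftrightarrow> (\<exists>n::nat. n > 0 \<and> z ^ n = 1)"


lemma matrix_inv_cancel:
  fixes A :: "complex^2^2"
  assumes "invertible A"
  shows "A ** matrix_inv A = mat 1" "matrix_inv A ** A = mat 1"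
    "A ** (matrix_inv A ** B) = B" "matrix_inv A ** (A ** B) = B"
proof -
  have "\<exists>A'. A ** A' = mat 1 \<and> A' ** A = mat 1"
    using assms by (simp only: invertible_def)
  then have *: "A ** matrix_inv A = mat 1 \<and> matrix_inv A ** A = mat 1"
    unfolding matrix_inv_def by (rule someI_ex)
  then show "A ** matrix_inv A = mat 1" "matrix_inv A ** A = mat 1"
    "A ** (matrix_inv A ** B) = B" "matrix_inv A ** (A ** B) = B"
    by (simp_all add: matrix_mul_assoc)
qed

lemma matrix_inv_eqI:
  fixes A B :: "complex^2^2"
  assumes "A ** B = mat 1" "B ** A = mat 1"
  shows "matrix_inv A = B"
proof -
  have "invertible A" using assms by (auto simp: invertible_def)
  have "matrix_inv A = matrix_inv A ** (A ** B)" by (simp only: assms matrix_mul_rid)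
  also have "\<dots> = B" using matrix_inv_cancel(4)[OF \<open>invertible A\<close>] .
  finally show ?thesis .
qed

lemma matrix_inv_mult2:
  fixes A B :: "complex^2^2"
  assumes "invertible A" "invertible B"
  shows "matrix_inv (A ** B) = matrix_inv B ** matrix_inv A"
  by (rule matrix_inv_eqI)
    (simp_all add: matrix_mul_assoc[symmetric] matrix_inv_cancel assms)

lemma invertible_matrix_inv2:
  fixes A :: "complex^2^2"
  assumes "invertible A"
  shows "invertible (matrix_inv A)" "matrix_inv (matrix_inv A) = A"
proof -
  note * = matrix_inv_cancel(1,2)[OF assms]
  show "invertible (matrix_inv A)" unfolding invertible_def using * by blast
  show "matrix_inv (matrix_inv A) = A" by (rule matrix_inv_eqI) (fact *)+
qed

lemma conj_op_conj_op:
  assumes "invertible P" "invertible R"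
  shows "conj_op (conj_op X P) R = conj_op X (P ** R)"
  by (simp add: conj_op_def matrix_inv_mult2 assms matrix_mul_assoc)

lemma invertible_diag2:
  assumes "a \<noteq> 0" "b \<noteq> 0"
  shows "invertible (diag2 a b)"
  using assms by (simp add: invertible_det_nz det_2 diag2_def)

lemma quandle_GL2_conj_class:
  assumes A: "A \<in> GL2"
  shows "quandle (GL2_conj_class A) conj_op"
proof -
  let ?C = "GL2_conj_class A"
  have inv: "invertible X" if "X \<in> ?C" for X
    using that A by (auto simp: GL2_conj_class_def GL2_def conj_op_def
        intro!: invertible_mult invertible_matrix_inv2)
  have conj: "conj_op X P \<in> ?C" if "X \<in> ?C" "invertible P" for X P
  proof -
    obtain R where R: "invertible R" "X = conj_op A R"
      using \<open>X \<in> ?C\<close> by (auto simp: GL2_conj_class_def GL2_def)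
    then have "conj_op X P = conj_op A (R ** P)"
      using \<open>invertible P\<close> by (simp add: conj_op_conj_op)
    then show ?thesis
      using R(1) \<open>invertible P\<close> invertible_mult by (auto simp: GL2_conj_class_def GL2_def)
  qed
  have mat1: "conj_op X (mat 1) = X" for X
    using matrix_inv_eqI[of "mat 1" "mat 1"] by (simp add: conj_op_def)
  show ?thesis
  proof
    have "conj_op A (mat 1) \<in> ?C"
      by (auto simp: GL2_conj_class_def GL2_def invertible_def intro!: exI[of _ "mat 1"])
    then show "?C \<noteq> {}" by blast
  next
    fix X Y assume "X \<in> ?C" "Y \<in> ?C"
    then show "conj_op X Y \<in> ?C" by (simp add: conj inv)
  next
    fix X assume "X \<in> ?C"
    then show "conj_op X X = X"
      by (simp add: conj_op_def matrix_inv_cancel inv matrix_mul_assoc[symmetric])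
  next
    fix X Y assume XY: "X \<in> ?C" "Y \<in> ?C"
    note Y = inv[OF XY(2)] and Y' = invertible_matrix_inv2[OF inv[OF XY(2)]]
    show "\<exists>!Z. Z \<in> ?C \<and> X = conj_op Z Y"
    proof (rule ex1I[of _ "conj_op X (matrix_inv Y)"])
      show "conj_op X (matrix_inv Y) \<in> ?C \<and> X = conj_op (conj_op X (matrix_inv Y)) Y"
        using XY Y Y' by (simp add: conj conj_op_conj_op matrix_inv_cancel mat1)
    next
      fix Z assume "Z \<in> ?C \<and> X = conj_op Z Y"
      then show "Z = conj_op X (matrix_inv Y)"
        using Y Y' by (simp add: conj_op_conj_op matrix_inv_cancel mat1)
    qed
  next
    fix X Y Z assume XYZ: "X \<in> ?C" "Y \<in> ?C" "Z \<in> ?C"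
    have "Z ** conj_op Y Z = Y ** Z"
      using XYZ inv by (simp add: conj_op_def matrix_mul_assoc[symmetric] matrix_inv_cancel)
    then show "conj_op (conj_op X Y) Z = conj_op (conj_op X Z) (conj_op Y Z)"
      using XYZ inv conj by (simp add: conj_op_conj_op)
  qed
qed

lemma quandle_M_quandle:
  assumes "a \<noteq> 0" "b \<noteq> 0"
  shows "quandle (M_quandle a b) conj_op"
  using quandle_GL2_conj_class[of "diag2 a b"] invertible_diag2[OF assms]
  by (simp add: M_quandle_def GL2_def)

end

theory Submission imports Defs begin

text \<open>
  The quandle structure of a conjugacy class does not mention matrix powers, but it does see
  conjugation by them: the \<open>n\<close>-fold right translation by \<open>Y\<close> is \<open>X \<mapsto> Y\<^sup>-\<^sup>n X Y\<^sup>n\<close>, and every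
  isomorphism \<open>\<phi>\<close> respects it. Hence \<open>X\<^sup>n \<mapsto> \<phi>(X)\<^sup>n\<close> is an isomorphism between the classes
  of \<open>n\<close>-th powers as soon as \<open>X \<mapsto> X\<^sup>n\<close> is injective on both sides, because
  \<open>Y\<^sup>-\<^sup>n X\<^sup>n Y\<^sup>n\<close> is the \<open>n\<close>-th power of \<open>Y\<^sup>-\<^sup>n X Y\<^sup>n\<close>.

  If \<open>a\<^sup>n \<noteq> b\<^sup>n\<close>, then \<open>X \<mapsto> X\<^sup>n\<close> is injective on the class of \<open>diag2 a b\<close>, since interpolation
  at the two eigenvalues gives one affine function recovering every \<open>X\<close> of the class from
  \<open>X\<^sup>n\<close> (\<open>affine_root_of_mat_power\<close>). On the source side \<open>l1\<^sup>n \<noteq> l2\<^sup>n\<close> is the hypothesis on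
  \<open>l2 / l1\<close>. On the target side it has to be read off from the quandle
  (\<open>isomorphic_imp_powers_distinct\<close>): if \<open>l1'\<^sup>n = l2'\<^sup>n\<close>, all \<open>n\<close>-th powers in the target
  class are scalar, so all \<open>n\<close>-fold translations are trivial there, and therefore also in the
  source class. But in the source an \<open>X\<close> that commutes with \<open>Y\<^sup>n\<close> commutes with \<open>Y\<close>, as \<open>Y\<close>
  is an affine function of \<open>Y\<^sup>n\<close>, so the source class would be commutative, which it is not.
\<close>

section \<open>Powers of matrices under conjugation\<close>

primrec mat_power :: "complex^2^2 \<Rightarrow> nat \<Rightarrow> complex^2^2"
  where
    "mat_power A 0 = mat 1"
  | "mat_power A (Suc n) = mat_power A n ** A"

lemma invertible_mat_power: "invertible A \<Longrightarrow> invertible (mat_power A n)"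
proof (induction n)
  case 0
  show ?case by (auto simp: invertible_def intro: exI[of _ "mat 1"])
next
  case (Suc n)
  then show ?case by (simp add: invertible_mult)
qed

lemma mat_power_diag2: "mat_power (diag2 a b) n = diag2 (a ^ n) (b ^ n)"
proof (induction n)
  case 0
  show ?case by (simp add: diag2_def mat_def vec_eq_iff forall_2)
next
  case (Suc n)
  then show ?case
    by (simp add: diag2_def matrix_matrix_mult_def vec_eq_iff forall_2 sum_2)
qed

lemma conj_op_mult:
  assumes "invertible P"
  shows "conj_op A P ** conj_op B P = conj_op (A ** B) P"
  by (simp add: conj_op_def matrix_mul_assoc[symmetric] matrix_inv_cancel assms)

lemma mat_mult_commute: "mat c ** A = A ** mat c" for A :: "complex^2^2"
  by (simp add: mat_def matrix_matrix_mult_def vec_eq_iff forall_2 sum_2)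

lemma conj_op_mat:
  assumes "invertible P"
  shows "conj_op (mat c) P = mat c"
  by (simp add: conj_op_def matrix_mul_assoc[symmetric] mat_mult_commute matrix_inv_cancel assms)

lemma matrix_add_rdistrib: "(A + B) ** C = A ** C + B ** C"
  by (simp add: matrix_matrix_mult_def vec_eq_iff distrib_right sum.distrib)

lemma conj_op_add: "conj_op (A + B) P = conj_op A P + conj_op B P"
  by (simp add: conj_op_def matrix_add_ldistrib matrix_add_rdistrib)

lemma conj_op_eq_iff_commute:
  assumes "invertible Y"
  shows "conj_op X Y = X \<longleftrightarrow> X ** Y = Y ** X"
proof
  assume "conj_op X Y = X"
  then have "Y ** conj_op X Y = Y ** X" by simp
  then show "X ** Y = Y ** X"
    by (simp add: conj_op_def matrix_mul_assoc[symmetric] matrix_inv_cancel assms)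
next
  assume "X ** Y = Y ** X"
  then show "conj_op X Y = X"
    by (simp add: conj_op_def matrix_mul_assoc[symmetric] matrix_inv_cancel assms)
qed

lemma mat_power_conj_op:
  assumes "invertible P"
  shows "mat_power (conj_op A P) n = conj_op (mat_power A n) P"
  by (induction n) (simp_all add: conj_op_mat conj_op_mult assms)

lemma funpow_conj_op:
  assumes "invertible Y"
  shows "((\<lambda>Z. conj_op Z Y) ^^ n) X = conj_op X (mat_power Y n)"
proof (induction n)
  case 0
  show ?case using matrix_inv_eqI[of "mat 1" "mat 1"] by (simp add: conj_op_def)
next
  case (Suc n)
  then show ?case by (simp add: conj_op_conj_op invertible_mat_power assms)
qed

section \<open>Powers on the conjugacy class of a diagonal matrix\<close>

lemma M_quandleE:
  assumes "X \<in> M_quandle a b"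
  obtains P where "invertible P" "X = conj_op (diag2 a b) P"
  using assms by (auto simp: M_quandle_def GL2_conj_class_def GL2_def)

lemma conj_op_diag2_in_M_quandle:
  "invertible P \<Longrightarrow> conj_op (diag2 a b) P \<in> M_quandle a b"
  by (auto simp: M_quandle_def GL2_conj_class_def GL2_def)

lemma invertible_M_quandle:
  assumes "X \<in> M_quandle a b" "a \<noteq> 0" "b \<noteq> 0"
  shows "invertible X"
  using assms(1)
  by (rule M_quandleE)
    (simp add: conj_op_def invertible_mult invertible_matrix_inv2 invertible_diag2 assms)

lemma mat_power_image_M_quandle:
  "(\<lambda>X. mat_power X n) ` M_quandle a b = M_quandle (a ^ n) (b ^ n)"
proof (intro equalityI subsetI)
  fix Z assume "Z \<in> (\<lambda>X. mat_power X n) ` M_quandle a b"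
  then show "Z \<in> M_quandle (a ^ n) (b ^ n)"
    by (auto elim!: M_quandleE simp: mat_power_conj_op mat_power_diag2
        intro: conj_op_diag2_in_M_quandle)
next
  fix Z assume "Z \<in> M_quandle (a ^ n) (b ^ n)"
  then obtain P where P: "invertible P" "Z = conj_op (diag2 (a ^ n) (b ^ n)) P"
    by (rule M_quandleE)
  then have "Z = mat_power (conj_op (diag2 a b) P) n"
    by (simp add: mat_power_conj_op mat_power_diag2)
  then show "Z \<in> (\<lambda>X. mat_power X n) ` M_quandle a b"
    using conj_op_diag2_in_M_quandle[OF P(1)] by blast
qed

text \<open>
  The affine function \<open>z \<mapsto> s z + t\<close> that sends \<open>a\<^sup>n\<close> to \<open>a\<close> and \<open>b\<^sup>n\<close> to \<open>b\<close> inverts the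
  power map on the diagonal matrix. Being affine, it commutes with conjugation, so the same
  coefficients serve for the whole class.
\<close>

lemma affine_root_of_mat_power:
  assumes "a ^ n \<noteq> b ^ n"
  obtains s t where "\<And>X. X \<in> M_quandle a b \<Longrightarrow> mat s ** mat_power X n + mat t = X"
proof -
  define s where "s = (a - b) / (a ^ n - b ^ n)"
  define t where "t = a - s * a ^ n"
  have "s * (a ^ n - b ^ n) = a - b"
    using assms by (simp add: s_def)
  then have a: "s * a ^ n + t = a" and b: "s * b ^ n + t = b"
    by (simp_all add: t_def algebra_simps)
  have diag: "mat s ** diag2 (a ^ n) (b ^ n) + mat t = diag2 a b"
    using a b
    by (simp add: diag2_def mat_def matrix_matrix_mult_def vec_eq_iff forall_2 sum_2)
  have "mat s ** mat_power X n + mat t = X" if "X \<in> M_quandle a b" for X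
    using that
  proof (rule M_quandleE)
    fix P assume P: "invertible P" and X: "X = conj_op (diag2 a b) P"
    have "mat s ** mat_power X n + mat t
        = conj_op (mat s) P ** conj_op (diag2 (a ^ n) (b ^ n)) P + conj_op (mat t) P"
      using P by (simp add: X mat_power_conj_op mat_power_diag2 conj_op_mat)
    also have "\<dots> = conj_op (mat s ** diag2 (a ^ n) (b ^ n) + mat t) P"
      using P by (simp only: conj_op_mult conj_op_add)
    finally show ?thesis by (simp add: diag X)
  qed
  then show ?thesis by (rule that)
qed

lemma bij_betw_mat_power:
  assumes "a ^ n \<noteq> b ^ n"
  shows "bij_betw (\<lambda>X. mat_power X n) (M_quandle a b) (M_quandle (a ^ n) (b ^ n))"
proof -
  obtain s t where "\<And>X. X \<in> M_quandle a b \<Longrightarrow> mat s ** mat_power X n + mat t = X"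
    using affine_root_of_mat_power[OF assms] by blast
  then have "inj_on (\<lambda>X. mat_power X n) (M_quandle a b)"
    by (intro inj_on_inverseI[where g = "\<lambda>Z. mat s ** Z + mat t"])
  then show ?thesis by (simp add: bij_betw_def mat_power_image_M_quandle)
qed

lemma commute_if_commute_mat_power:
  assumes "a ^ n \<noteq> b ^ n" and Y: "Y \<in> M_quandle a b"
    and comm: "X ** mat_power Y n = mat_power Y n ** X"
  shows "X ** Y = Y ** X"
proof -
  obtain s t where "mat s ** mat_power Y n + mat t = Y"
    using affine_root_of_mat_power[OF assms(1)] Y by blast
  moreover have "X ** (mat s ** mat_power Y n + mat t)
      = (mat s ** mat_power Y n + mat t) ** X"
  proof -
    have "X ** (mat s ** mat_power Y n) = mat s ** (X ** mat_power Y n)"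
      by (simp only: matrix_mul_assoc mat_mult_commute[of s X])
    then show ?thesis
      by (simp add: matrix_add_ldistrib matrix_add_rdistrib comm matrix_mul_assoc[symmetric]
          mat_mult_commute[of t X])
  qed
  ultimately show ?thesis by simp
qed

lemma M_quandle_not_commutative:
  assumes "a \<noteq> b"
  obtains X Y where "X \<in> M_quandle a b" "Y \<in> M_quandle a b" "X ** Y \<noteq> Y ** X"
proof -
  define P :: "complex^2^2" where "P = vector [vector [1, 1], vector [0, 1]]"
  define P' :: "complex^2^2" where "P' = vector [vector [1, -1], vector [0, 1]]"
  define X :: "complex^2^2" where "X = vector [vector [a, a - b], vector [0, b]]"
  have PP': "P ** P' = mat 1" "P' ** P = mat 1"
    by (simp_all add: P_def P'_def mat_def matrix_matrix_mult_def vec_eq_iff forall_2 sum_2)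
  have P: "invertible P" using PP' by (auto simp: invertible_def)
  have "conj_op (diag2 a b) P = X"
    unfolding conj_op_def matrix_inv_eqI[OF PP']
    by (simp add: P_def P'_def X_def diag2_def matrix_matrix_mult_def vec_eq_iff forall_2 sum_2)
  then have X: "X \<in> M_quandle a b" using conj_op_diag2_in_M_quandle[OF P] by metis
  have "conj_op (diag2 a b) (mat 1) = diag2 a b"
    using matrix_inv_eqI[of "mat 1" "mat 1"] by (simp add: conj_op_def)
  moreover have "invertible (mat 1 :: complex^2^2)"
    using invertible_mat_power[OF P, of 0] by simp
  ultimately have D: "diag2 a b \<in> M_quandle a b"
    using conj_op_diag2_in_M_quandle by metis
  have "(X ** diag2 a b) $ 1 $ 2 \<noteq> (diag2 a b ** X) $ 1 $ 2"
    using assms by (simp add: X_def diag2_def matrix_matrix_mult_def sum_2)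
  then have "X ** diag2 a b \<noteq> diag2 a b ** X" by auto
  with X D show ?thesis by (rule that)
qed

section \<open>Transport along a quandle isomorphism\<close>

lemma (in quandle) quandle_iso_funpow:
  assumes iso: "quandle_iso Q op Q' op' \<phi>" and "x \<in> Q" "y \<in> Q"
  shows "((\<lambda>z. op z y) ^^ n) x \<in> Q"
    and "\<phi> (((\<lambda>z. op z y) ^^ n) x) = ((\<lambda>z. op' z (\<phi> y)) ^^ n) (\<phi> x)"
proof -
  have "((\<lambda>z. op z y) ^^ n) x \<in> Q \<and>
      \<phi> (((\<lambda>z. op z y) ^^ n) x) = ((\<lambda>z. op' z (\<phi> y)) ^^ n) (\<phi> x)"
    using assms by (induction n) (auto simp: quandle_iso_def closed)
  then show "((\<lambda>z. op z y) ^^ n) x \<in> Q"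
    and "\<phi> (((\<lambda>z. op z y) ^^ n) x) = ((\<lambda>z. op' z (\<phi> y)) ^^ n) (\<phi> x)"
    by simp_all
qed

lemma quandle_iso_conj_mat_power:
  assumes nz: "a \<noteq> 0" "b \<noteq> 0" "a' \<noteq> 0" "b' \<noteq> 0"
    and iso: "quandle_iso (M_quandle a b) conj_op (M_quandle a' b') conj_op \<phi>"
    and X: "X \<in> M_quandle a b" and Y: "Y \<in> M_quandle a b"
  shows "conj_op X (mat_power Y n) \<in> M_quandle a b"
    and "\<phi> (conj_op X (mat_power Y n)) = conj_op (\<phi> X) (mat_power (\<phi> Y) n)"
proof -
  interpret quandle "M_quandle a b" conj_op
    using nz by (intro quandle_M_quandle)
  have "\<phi> Y \<in> M_quandle a' b'"
    using iso Y by (auto simp: quandle_iso_def bij_betw_def)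
  then have "invertible Y" "invertible (\<phi> Y)"
    using Y nz by (auto intro: invertible_M_quandle)
  then show "conj_op X (mat_power Y n) \<in> M_quandle a b"
    and "\<phi> (conj_op X (mat_power Y n)) = conj_op (\<phi> X) (mat_power (\<phi> Y) n)"
    using quandle_iso_funpow[OF iso X Y, of n] by (simp_all add: funpow_conj_op)
qed

text \<open>
  Distinctness of the \<open>n\<close>-th powers of the eigenvalues is visible in the quandle: it fails
  exactly when all \<open>n\<close>-fold right translations are trivial.
\<close>

lemma isomorphic_imp_powers_distinct:
  assumes nz: "a \<noteq> 0" "b \<noteq> 0" "a' \<noteq> 0" "b' \<noteq> 0"
    and iso: "quandle_iso (M_quandle a b) conj_op (M_quandle a' b') conj_op \<phi>"
    and ab: "a ^ n \<noteq> b ^ n"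
  shows "a' ^ n \<noteq> b' ^ n"
proof
  assume eq: "a' ^ n = b' ^ n"
  have "a \<noteq> b" using ab by auto
  then obtain X Y where X: "X \<in> M_quandle a b" and Y: "Y \<in> M_quandle a b"
    and XY: "X ** Y \<noteq> Y ** X"
    by (rule M_quandle_not_commutative)
  have \<phi>Y: "\<phi> Y \<in> M_quandle a' b'"
    using iso Y by (auto simp: quandle_iso_def bij_betw_def)
  have scalar: "mat_power (\<phi> Y) n = mat (a' ^ n)"
    using \<phi>Y
  proof (rule M_quandleE)
    fix P assume P: "invertible P" and "\<phi> Y = conj_op (diag2 a' b') P"
    moreover have "diag2 (a' ^ n) (a' ^ n) = mat (a' ^ n)"
      by (simp add: diag2_def mat_def vec_eq_iff forall_2)
    ultimately show ?thesis
      by (simp add: mat_power_conj_op mat_power_diag2 eq[symmetric] conj_op_mat)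
  qed
  have inv: "invertible (mat_power (\<phi> Y) n)" "invertible (mat_power Y n)"
    using Y \<phi>Y nz by (auto intro: invertible_mat_power invertible_M_quandle)
  have "\<phi> (conj_op X (mat_power Y n)) = conj_op (\<phi> X) (mat_power (\<phi> Y) n)"
    by (rule quandle_iso_conj_mat_power(2)[OF nz iso X Y])
  also have "\<dots> = \<phi> X"
    using inv(1) by (simp add: conj_op_eq_iff_commute scalar mat_mult_commute)
  finally have "conj_op X (mat_power Y n) = X"
    using iso X quandle_iso_conj_mat_power(1)[OF nz iso X Y]
    by (auto simp: quandle_iso_def bij_betw_def dest: inj_onD)
  then have "X ** mat_power Y n = mat_power Y n ** X"
    using inv(2) by (simp add: conj_op_eq_iff_commute)
  then show False
    using commute_if_commute_mat_power[OF ab Y] XY by blast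
qed

text \<open>The isomorphism is \<open>X\<^sup>n \<mapsto> \<phi>(X)\<^sup>n\<close>.\<close>

lemma isomorphic_M_quandle_power:
  assumes nz: "a \<noteq> 0" "b \<noteq> 0" "a' \<noteq> 0" "b' \<noteq> 0"
    and "isomorphic_quandles (M_quandle a b) conj_op (M_quandle a' b') conj_op"
    and ab: "a ^ n \<noteq> b ^ n"
  shows "isomorphic_quandles (M_quandle (a ^ n) (b ^ n)) conj_op
    (M_quandle (a' ^ n) (b' ^ n)) conj_op"
proof -
  obtain \<phi> where iso: "quandle_iso (M_quandle a b) conj_op (M_quandle a' b') conj_op \<phi>"
    using assms(5) by (auto simp: isomorphic_quandles_def)
  define root where "root = the_inv_into (M_quandle a b) (\<lambda>X. mat_power X n)"
  define \<psi> where "\<psi> = (\<lambda>Z. mat_power (\<phi> (root Z)) n)"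
  note bij = bij_betw_mat_power[OF ab]
  have \<psi>_power: "\<psi> (mat_power X n) = mat_power (\<phi> X) n" if "X \<in> M_quandle a b" for X
    using the_inv_into_f_f[OF bij_betw_imp_inj_on[OF bij] that]
    by (simp add: \<psi>_def root_def)
  have "bij_betw root (M_quandle (a ^ n) (b ^ n)) (M_quandle a b)"
    unfolding root_def by (rule bij_betw_the_inv_into[OF bij])
  moreover have "bij_betw \<phi> (M_quandle a b) (M_quandle a' b')"
    using iso by (simp add: quandle_iso_def)
  moreover have "bij_betw (\<lambda>X. mat_power X n) (M_quandle a' b') (M_quandle (a' ^ n) (b' ^ n))"
    by (rule bij_betw_mat_power[OF isomorphic_imp_powers_distinct[OF nz iso ab]])
  ultimately have "bij_betw ((\<lambda>X. mat_power X n) \<circ> (\<phi> \<circ> root))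
      (M_quandle (a ^ n) (b ^ n)) (M_quandle (a' ^ n) (b' ^ n))"
    by (intro bij_betw_trans)
  then have "bij_betw \<psi> (M_quandle (a ^ n) (b ^ n)) (M_quandle (a' ^ n) (b' ^ n))"
    by (simp add: \<psi>_def comp_def)
  moreover have "\<psi> (conj_op U V) = conj_op (\<psi> U) (\<psi> V)"
    if UV: "U \<in> M_quandle (a ^ n) (b ^ n)" "V \<in> M_quandle (a ^ n) (b ^ n)" for U V
  proof -
    obtain X Y where X: "X \<in> M_quandle a b" "U = mat_power X n"
      and Y: "Y \<in> M_quandle a b" "V = mat_power Y n"
      using UV by (auto simp: mat_power_image_M_quandle[symmetric])
    have "\<phi> Y \<in> M_quandle a' b'"
      using iso Y by (auto simp: quandle_iso_def bij_betw_def)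
    then have inv: "invertible (mat_power Y n)" "invertible (mat_power (\<phi> Y) n)"
      using Y nz by (auto intro: invertible_mat_power invertible_M_quandle)
    have "\<psi> (conj_op U V) = \<psi> (mat_power (conj_op X (mat_power Y n)) n)"
      by (simp add: X Y mat_power_conj_op inv)
    also have "\<dots> = mat_power (conj_op (\<phi> X) (mat_power (\<phi> Y) n)) n"
      by (simp add: \<psi>_power quandle_iso_conj_mat_power[OF nz iso X(1) Y(1)])
    also have "\<dots> = conj_op (\<psi> U) (\<psi> V)"
      by (simp add: X Y mat_power_conj_op inv \<psi>_power)
    finally show ?thesis .
  qed
  ultimately have "quandle_iso (M_quandle (a ^ n) (b ^ n)) conj_op
      (M_quandle (a' ^ n) (b' ^ n)) conj_op \<psi>"
    by (simp add: quandle_iso_def)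
  then show ?thesis
    using nz by (auto simp: isomorphic_quandles_def intro!: quandle_M_quandle)
qed

theorem theorem6p4:
  fixes l1 l2 l1' l2' :: complex
  assumes "l1 \<noteq> 0" and "l2 \<noteq> 0" and "l1' \<noteq> 0" and "l2' \<noteq> 0"
    and "isomorphic_quandles (M_quandle l1 l2) conj_op (M_quandle l1' l2') conj_op"
    and "\<not> root_of_unity (l2 / l1)"
  shows "\<forall>n::nat. n > 0 \<longrightarrow>
    isomorphic_quandles (M_quandle (l1 ^ n) (l2 ^ n)) conj_op (M_quandle (l1' ^ n) (l2' ^ n)) conj_op"
proof (intro allI impI)
  fix n :: nat assume "n > 0"
  then have "(l2 / l1) ^ n \<noteq> 1"
    using assms(6) unfolding root_of_unity_def by blast
  then have "l1 ^ n \<noteq> l2 ^ n"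
    using assms(1) by (auto simp: power_divide)
  then show "isomorphic_quandles (M_quandle (l1 ^ n) (l2 ^ n)) conj_op
      (M_quandle (l1' ^ n) (l2' ^ n)) conj_op"
    using assms(1-5) by (intro isomorphic_M_quandle_power)
qed

end
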